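(* Let $X$ be a nontrivial real Banach space, let $C\subseteq X$ be a nonempty, convex and closed set with $\operatorname{sqri}(C)\neq\emptyset$, and let $F:C\times C\to\mathbb{R}$ satisfy $F(x,x)=0$ for all $x\in C$. Assume that $F(x,\cdot)$ is convex and lower semicontinuous for all $x\in C$ and that $F(\cdot,y)$ is concave and upper semicontinuous for all $y\in C$. Then $A^F$ is a maximal monotone operator and $A^F={}^F\!A$.
   Context: $X^*$ is the topological dual of $X$ and $\langle x^*,x\rangle$ the value of $x^*\in X^*$ at $x\in X$. For a convex set $U\subseteq X$, the strong quasi relative interior is $\operatorname{sqri}(U)=\{x\in U:\operatorname{cone}(U-x)\text{ is a closed linear subspace}\}$, where $\operatorname{cone}$ denotes the conical hull. For a function $F:C\times C\to\mathbb{R}$ (a bifunction), the operators $A^F,{}^F\!A:X\rightrightarrows X^*$ are defined by $$A^F(x)=\{x^*\in X^*:F(x,y)-F(x,x)\ge\langle x^*,y-x\rangle\ \forall y\in C\},\qquad {}^F\!A(x)=\{x^*\in X^*:F(x,x)-F(y,x)\ge\langle x^*,y-x\rangle\ \forall y\in C\}$$ if $x\in C$, and $A^F(x)={}^F\!A(x)=\emptyset$ if $x\notin C$. A multifunction $T:X\rightrightarrows X^*$ is monotone if $\langle y^*-x^*,y-x\rangle\ge 0$ whenever $x^*\in T(x)$, $y^*\in T(y)$; it is maximal monotone if moreover its graph is not properly included in the graph of another monotone operator. Note that $F$ is not assumed monotone. *)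

theory Defs
  imports "HOL-Analysis.Analysis"
begin

text \<open>The topological dual of \<open>'a\<close> is the type \<open>'a \<Rightarrow>\<^sub>L real\<close>, and the pairing of
  a functional with a vector is application of the bounded linear map.\<close>

definition sqri :: "'a::real_normed_vector set \<Rightarrow> 'a set" where
  "sqri U = {x \<in> U. subspace (cone hull ((\<lambda>u. u - x) ` U)) \<and>
                     closed (cone hull ((\<lambda>u. u - x) ` U))}"

text \<open>Semicontinuity relative to the subspace topology of \<open>S\<close>; values outside \<open>S\<close> are irrelevant.\<close>

definition lower_semicontinuous_on :: "'a::topological_space set \<Rightarrow> ('a \<Rightarrow> real) \<Rightarrow> bool" where
  "lower_semicontinuous_on S f \<longleftrightarrow>
     (\<forall>x\<in>S. \<forall>r. r < f x \<longrightarrow> (\<forall>\<^sub>F y in at x within S. r < f y))"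

definition upper_semicontinuous_on :: "'a::topological_space set \<Rightarrow> ('a \<Rightarrow> real) \<Rightarrow> bool" where
  "upper_semicontinuous_on S f \<longleftrightarrow>
     (\<forall>x\<in>S. \<forall>r. f x < r \<longrightarrow> (\<forall>\<^sub>F y in at x within S. f y < r))"

text \<open>A bifunction on \<open>C\<close> is a function \<open>'a \<Rightarrow> 'a \<Rightarrow> real\<close> of which only the values on \<open>C \<times> C\<close> are used.
  The operators \<open>A\<^sup>F\<close> and \<open>\<^sup>FA\<close> are \<open>bifun_op C F\<close> and \<open>bifun_op_left C F\<close>.\<close>

definition bifun_op ::
    "'a::real_normed_vector set \<Rightarrow> ('a \<Rightarrow> 'a \<Rightarrow> real) \<Rightarrow> 'a \<Rightarrow> ('a \<Rightarrow>\<^sub>L real) set" where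
  "bifun_op C F x =
     (if x \<in> C then {xs. \<forall>y\<in>C. F x y - F x x \<ge> blinfun_apply xs (y - x)} else {})"

definition bifun_op_left ::
    "'a::real_normed_vector set \<Rightarrow> ('a \<Rightarrow> 'a \<Rightarrow> real) \<Rightarrow> 'a \<Rightarrow> ('a \<Rightarrow>\<^sub>L real) set" where
  "bifun_op_left C F x =
     (if x \<in> C then {xs. \<forall>y\<in>C. F x x - F y x \<ge> blinfun_apply xs (y - x)} else {})"

definition op_graph :: "('a::real_normed_vector \<Rightarrow> ('a \<Rightarrow>\<^sub>L real) set) \<Rightarrow> ('a \<times> ('a \<Rightarrow>\<^sub>L real)) set" where
  "op_graph T = {(x, xs). xs \<in> T x}"

definition monotone_operator :: "('a::real_normed_vector \<Rightarrow> ('a \<Rightarrow>\<^sub>L real) set) \<Rightarrow> bool" where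
  "monotone_operator T \<longleftrightarrow>
     (\<forall>x y. \<forall>xs\<in>T x. \<forall>ys\<in>T y. blinfun_apply (ys - xs) (y - x) \<ge> 0)"

definition maximal_monotone_operator :: "('a::real_normed_vector \<Rightarrow> ('a \<Rightarrow>\<^sub>L real) set) \<Rightarrow> bool" where
  "maximal_monotone_operator T \<longleftrightarrow>
     monotone_operator T \<and> \<not> (\<exists>S. monotone_operator S \<and> op_graph T \<subset> op_graph S)"

end

theory Submission
  imports Defs
begin

text \<open>
  The equality of the two operators comes from evaluating \<open>0 = F u u\<close> at points \<open>u\<close> of a segment
  \<open>[x, y]\<close> and letting \<open>u\<close> tend to \<open>x\<close>; monotonicity follows at once.

  For maximality, fix \<open>x0\<close> in \<open>sqri C\<close> and let \<open>L\<close> be the closed subspace \<open>cone (C - x0)\<close>. By Baire's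
  theorem \<open>C\<close> is a neighbourhood of \<open>x0\<close> relative to \<open>x0 + L\<close> and \<open>F x\<close> is bounded there, so
  \<open>A\<^sup>F\<close> has values at every relative core point of \<open>C\<close>. Let \<open>(z, zs)\<close> be monotonically related to
  the graph of \<open>A\<^sup>F\<close>. If \<open>z \<in> C\<close>, test with points of the segment from \<open>z\<close> to a core point and pass
  to the limit. If \<open>z \<notin> C\<close>, let \<open>b\<close> be the last point of \<open>C\<close> on the segment from \<open>x0\<close> to \<open>z\<close>. Monotone
  relatedness keeps the values of \<open>A\<^sup>F\<close> on \<open>[x0, b)\<close> bounded on \<open>L\<close>, hence \<open>F b\<close> has at most linear
  decay at \<open>b\<close> and \<open>A\<^sup>F\<close> has a value \<open>bs\<close> at \<open>b\<close>. Adding to \<open>bs\<close> large multiples of a normal \<open>l\<close> to \<open>C\<close>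
  at \<open>b\<close> with \<open>l (z - b) > 0\<close> contradicts the relatedness.\<close>

section \<open>Linear minorants\<close>

text \<open>Homogeneity is demanded as an inequality only, which is easier to verify for infima;
  \<open>sublinear_scale\<close> recovers equality.\<close>

definition sublinear :: "('a::real_vector \<Rightarrow> real) \<Rightarrow> bool" where
  "sublinear p \<longleftrightarrow> (\<forall>x y. p (x + y) \<le> p x + p y) \<and> (\<forall>t x. 0 \<le> t \<longrightarrow> p (t *\<^sub>R x) \<le> t * p x)"

lemma sublinear_add: "sublinear p \<Longrightarrow> p (x + y) \<le> p x + p y"
  and sublinear_scale_le: "sublinear p \<Longrightarrow> 0 \<le> t \<Longrightarrow> p (t *\<^sub>R x) \<le> t * p x"
  by (auto simp: sublinear_def)

lemma sublinear_zero: "sublinear p \<Longrightarrow> p 0 = 0"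
  using sublinear_add[of p 0 0] sublinear_scale_le[of p 0 0] by simp

lemma sublinear_minus: "sublinear p \<Longrightarrow> - p (- x) \<le> p x"
  using sublinear_add[of p x "- x"] sublinear_zero[of p] by simp

lemma sublinear_scale:
  assumes p: "sublinear p" and "0 \<le> t"
  shows "p (t *\<^sub>R x) = t * p x"
proof (cases "t = 0")
  case False
  then show ?thesis
    using assms sublinear_scale_le[OF p, of t x] sublinear_scale_le[OF p, of "inverse t" "t *\<^sub>R x"]
    by (simp add: field_simps)
qed (simp add: sublinear_zero[OF p])

lemma convex_onD':
  assumes "convex_on S f" "x \<in> S" "y \<in> S" "0 \<le> s" "0 \<le> t" "s + t = 1"
  shows "f (s *\<^sub>R x + t *\<^sub>R y) \<le> s * f x + t * f y"
  using assms by (simp add: convex_on_def)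

text \<open>The bound \<open>le\<close> keeps the infimum that defines the minorant finite. With
  \<open>q\<close> a multiple of the norm this leads to continuous minorants; with \<open>S\<close>
  a singleton it makes minimal sublinear functionals odd.\<close>

lemma sublinear_minorant:
  fixes q :: "'a::real_vector \<Rightarrow> real"
  assumes q: "sublinear q" and f: "convex_on S f" and "S \<noteq> {}"
    and le: "\<And>y. y \<in> S \<Longrightarrow> - q (- y) \<le> f y"
  obtains p where "sublinear p" "\<And>x. p x \<le> q x" "\<And>y. y \<in> S \<Longrightarrow> p y \<le> f y"
proof -
  \<comment> \<open>\<open>p\<close> is the infimal convolution of \<open>q\<close> with the positively homogeneous hull of \<open>f\<close>.\<close>
  define Q where "Q x t y = t * f y + q (x - t *\<^sub>R y)" for x t y
  define p where "p x = Inf {Q x t y | t y. 0 \<le> t \<and> y \<in> S}" for x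
  \<comment> \<open>Writing -t y as (x - t y) + (-x) gives a lower bound free of \<open>t\<close>
    and \<open>y\<close>.\<close>
  have low: "- q (- x) \<le> Q x t y" if "0 \<le> t" "y \<in> S" for x t y
  proof -
    have "t * - q (- y) \<le> t * f y"
      using le[OF that(2)] that(1) by (rule mult_left_mono)
    moreover have "q (t *\<^sub>R (- y)) \<le> q (x - t *\<^sub>R y) + q (- x)"
      using sublinear_add[OF q, of "x - t *\<^sub>R y" "- x"] by simp
    ultimately show ?thesis
      unfolding sublinear_scale[OF q that(1)] Q_def by simp
  qed
  have bdd: "bdd_below {Q x t y | t y. 0 \<le> t \<and> y \<in> S}" for x
    using low unfolding bdd_below_def by blast
  have p_le: "p x \<le> Q x t y" if "0 \<le> t" "y \<in> S" for x t y
    unfolding p_def by (rule cInf_lower[OF _ bdd]) (use that in blast)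
  have p_ge: "c \<le> p x" if "\<And>t y. 0 \<le> t \<Longrightarrow> y \<in> S \<Longrightarrow> c \<le> Q x t y" for c x
    unfolding p_def using \<open>S \<noteq> {}\<close> by (intro cInf_greatest) (auto intro!: that intro: order_refl)
  have sum: "p (x + x') \<le> Q x s y + Q x' t y'"
    if "0 \<le> s" "y \<in> S" "0 \<le> t" "y' \<in> S" for x x' s t y y'
  proof (cases "s + t = 0")
    case True
    then have "s = 0" "t = 0" using that by auto
    then show ?thesis
      using p_le[of 0 y "x + x'"] sublinear_add[OF q, of x x'] that by (simp add: Q_def)
  next
    case False
    define u where "u = s + t"
    have u: "0 < u" using False that by (simp add: u_def)
    \<comment> \<open>The weighted mean \<open>m\<close>, with multiplier \<open>u\<close>, merges
      the competitors for \<open>x\<close> and \<open>x'\<close> into one for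
      \<open>x + x'\<close>.\<close>
    define m where "m = (s / u) *\<^sub>R y + (t / u) *\<^sub>R y'"
    have w: "s / u + t / u = 1" "0 \<le> s / u" "0 \<le> t / u"
      using u that by (auto simp: u_def simp flip: add_divide_distrib)
    have m: "m \<in> S" unfolding m_def
      using convexD[OF convex_on_imp_convex[OF f] that(2,4) w(2,3,1)] .
    have um: "u *\<^sub>R m = s *\<^sub>R y + t *\<^sub>R y'"
      using u by (simp add: m_def scaleR_add_right)
    have "f m \<le> (s / u) * f y + (t / u) * f y'"
      unfolding m_def by (rule convex_onD'[OF f that(2,4) w(2,3,1)])
    then have "u * f m \<le> u * ((s / u) * f y + (t / u) * f y')"
      using u by (intro mult_left_mono) auto
    also have "\<dots> = s * f y + t * f y'"
      using u by (simp add: distrib_left)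
    finally have "u * f m \<le> s * f y + t * f y'" .
    moreover have "q (x + x' - u *\<^sub>R m) \<le> q (x - s *\<^sub>R y) + q (x' - t *\<^sub>R y')"
      using sublinear_add[OF q, of "x - s *\<^sub>R y" "x' - t *\<^sub>R y'"] by (simp add: um algebra_simps)
    moreover have "p (x + x') \<le> Q (x + x') u m"
      using p_le u m by simp
    ultimately show ?thesis by (simp add: Q_def)
  qed
  have "sublinear p"
    unfolding sublinear_def
  proof (intro conjI allI impI)
    fix x x'
    have "p (x + x') - p x' \<le> Q x s y" if "0 \<le> s" "y \<in> S" for s y
    proof -
      have "p (x + x') - Q x s y \<le> p x'"
        using sum that by (intro p_ge) (simp add: diff_le_eq add.commute)
      then show ?thesis by simp
    qed
    from p_ge[OF this] show "p (x + x') \<le> p x + p x'" by simp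
  next
    fix t :: real and x
    assume "0 \<le> t"
    show "p (t *\<^sub>R x) \<le> t * p x"
    proof (cases "t = 0")
      case True
      obtain y where "y \<in> S" using \<open>S \<noteq> {}\<close> by blast
      then show ?thesis using True p_le[of 0 y 0] sublinear_zero[OF q] by (simp add: Q_def)
    next
      case False
      then have t: "0 < t" using \<open>0 \<le> t\<close> by simp
      have "p (t *\<^sub>R x) / t \<le> Q x s y" if "0 \<le> s" "y \<in> S" for s y
      proof -
        have "p (t *\<^sub>R x) \<le> Q (t *\<^sub>R x) (t * s) y"
          using p_le t that by simp
        also have "\<dots> \<le> t * Q x s y"
          using sublinear_scale_le[OF q \<open>0 \<le> t\<close>, of "x - s *\<^sub>R y"]
          by (simp add: Q_def algebra_simps)
        finally show ?thesis using t by (simp add: field_simps)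
      qed
      from p_ge[OF this] show ?thesis using t by (simp add: field_simps)
    qed
  qed
  \<comment> \<open>Multiplier 0 gives the bound by \<open>q\<close>, multiplier 1 at
    \<open>y\<close> itself the bound by \<open>f\<close>.\<close>
  moreover have "p x \<le> q x" for x
    using \<open>S \<noteq> {}\<close> p_le[of 0 _ x] by (auto simp: Q_def)
  moreover have "p y \<le> f y" if "y \<in> S" for y
    using p_le[of 1 y y] that sublinear_zero[OF q] by (simp add: Q_def)
  ultimately show thesis by (rule that)
qed

text \<open>Hahn-Banach by Zorn's lemma on the sublinear functionals below \<open>p\<close>: infima
  of chains stay real because \<open>- p (- x)\<close> bounds them from below at
  \<open>x\<close>.\<close>

lemma linear_minorant:
  fixes p :: "'a::real_vector \<Rightarrow> real"
  assumes p: "sublinear p"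
  obtains l where "linear l" "\<And>x. l x \<le> p x"
proof -
  \<comment> \<open>A minimal sublinear functional is linear.\<close>
  define A where "A = {q. sublinear q \<and> q \<le> p}"
  \<comment> \<open>The order is reversed, so that a maximal element for \<open>P\<close> is a
    minimal functional.\<close>
  define P where "P f g \<longleftrightarrow> g \<le> f" for f g :: "'a \<Rightarrow> real"
  have po: "partial_order_on A (relation_of P A)"
    unfolding P_def by (rule partial_order_on_relation_ofI) auto
  have chain: "\<exists>u\<in>A. \<forall>a\<in>K. P a u" if K: "K \<in> Chains (relation_of P A)" for K
  proof (cases "K = {}")
    case True
    then show ?thesis using p by (auto simp: A_def)
  next
    case False
    have KA: "K \<subseteq> A" and tot: "\<And>f g. f \<in> K \<Longrightarrow> g \<in> K \<Longrightarrow> f \<le> g \<or> g \<le> f"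
      using K by (auto simp: Chains_def relation_of_def P_def)
    define u where "u x = (INF f\<in>K. f x)" for x
    have bdd: "bdd_below ((\<lambda>f. f x) ` K)" for x
    proof (rule bdd_belowI2)
      fix f assume "f \<in> K"
      then have "sublinear f" "f (- x) \<le> p (- x)" using KA by (auto simp: A_def le_fun_def)
      then show "- p (- x) \<le> f x" using sublinear_minus[of f x] by simp
    qed
    have u_le: "u x \<le> f x" if "f \<in> K" for f x
      unfolding u_def using cINF_lower[OF bdd that] .
    have u_ge: "c \<le> u x" if "\<And>f. f \<in> K \<Longrightarrow> c \<le> f x" for c x
      unfolding u_def using cINF_greatest[OF False that] .
    have sub: "sublinear f" if "f \<in> K" for f using that KA by (auto simp: A_def)
    have "sublinear u"
      unfolding sublinear_def
    proof (intro conjI allI impI)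
      fix x y
      \<comment> \<open>In a chain one of \<open>f\<close>, \<open>g\<close> lies below the other
        and can serve at both points.\<close>
      have *: "u (x + y) \<le> f x + g y" if "f \<in> K" "g \<in> K" for f g
        using tot[OF that] u_le[OF that(1), of "x + y"] u_le[OF that(2), of "x + y"]
          sublinear_add[OF sub[OF that(1)], of x y] sublinear_add[OF sub[OF that(2)], of x y]
        by (auto simp: le_fun_def) (smt (verit))+
      have "u (x + y) - u y \<le> f x" if "f \<in> K" for f
      proof -
        have "u (x + y) - f x \<le> u y"
          using *[OF that] by (intro u_ge) (simp add: diff_le_eq add.commute[of "f x"])
        then show ?thesis by simp
      qed
      then have "u (x + y) - u y \<le> u x" by (rule u_ge)
      then show "u (x + y) \<le> u x + u y" by simp
    next
      fix t :: real and x
      assume "0 \<le> t"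
      obtain f where f: "f \<in> K" using False by blast
      show "u (t *\<^sub>R x) \<le> t * u x"
      proof (cases "t = 0")
        case True
        then show ?thesis using u_le[OF f, of 0] sublinear_zero[OF sub[OF f]] by simp
      next
        case False
        then have t: "0 < t" using \<open>0 \<le> t\<close> by simp
        have "u (t *\<^sub>R x) / t \<le> f x" if "f \<in> K" for f
          using u_le[OF that, of "t *\<^sub>R x"] sublinear_scale_le[OF sub[OF that] \<open>0 \<le> t\<close>, of x] t
          by (simp add: field_simps)
        then have "u (t *\<^sub>R x) / t \<le> u x" by (rule u_ge)
        then show ?thesis using t by (simp add: field_simps)
      qed
    qed
    moreover have "u \<le> p"
    proof (rule le_funI)
      fix x
      obtain f where f: "f \<in> K" using False by blast
      then have "f x \<le> p x" using KA by (auto simp: A_def le_fun_def)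
      then show "u x \<le> p x" using u_le[OF f, of x] by simp
    qed
    ultimately show ?thesis
      using u_le by (intro bexI[of _ u]) (auto simp: A_def P_def le_fun_def)
  qed
  obtain l where l: "l \<in> A" and min: "\<And>q. q \<in> A \<Longrightarrow> q \<le> l \<Longrightarrow> q = l"
    using predicate_Zorn[OF po chain] unfolding P_def by blast
  have sl: "sublinear l" using l by (simp add: A_def)
  \<comment> \<open>Capping \<open>l\<close> by the value \<open>- l x\<close> at \<open>- x\<close>
    yields a sublinear functional below \<open>l\<close>, which minimality identifies with
    \<open>l\<close>.\<close>
  have odd: "l (- x) = - l x" for x
  proof -
    obtain q where q: "sublinear q" "\<And>y. q y \<le> l y" "\<And>y. y \<in> {- x} \<Longrightarrow> q y \<le> - l x"
      by (rule sublinear_minorant[OF sl, of "{- x}" "\<lambda>_. - l x"])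
         (auto simp: convex_on_const)
    have "q \<in> A" using q(1,2) l by (auto simp: A_def le_fun_def intro: order_trans)
    then have "q = l" using min q(2) by (simp add: le_fun_def)
    then show ?thesis using q(3)[of "- x"] sublinear_minus[OF sl, of x] by simp
  qed
  have "linear l"
  proof (rule linearI)
    show "l (x + y) = l x + l y" for x y
      using sublinear_add[OF sl, of x y] sublinear_add[OF sl, of "- x" "- y"] odd[of "x + y"]
        odd[of x] odd[of y] by simp
  next
    have pos: "l (t *\<^sub>R x) = t * l x" if "0 \<le> t" for t x
      using sublinear_scale_le[OF sl that, of x] sublinear_scale_le[OF sl that, of "- x"]
        odd[of "t *\<^sub>R x"] odd[of x] by simp
    show "l (t *\<^sub>R x) = t *\<^sub>R l x" for t x
      using pos[of t x] pos[of "- t" x] odd[of "t *\<^sub>R x"] by (cases "0 \<le> t") auto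
  qed
  moreover have "l x \<le> p x" for x using l by (simp add: A_def le_fun_def)
  ultimately show thesis by (rule that)
qed

section \<open>Continuous linear minorants and separation from a convex cone\<close>

lemma blinfun_minorant:
  fixes f :: "'a::real_normed_vector \<Rightarrow> real"
  assumes f: "convex_on S f" and le: "\<And>y. y \<in> S \<Longrightarrow> - (K * norm y) \<le> f y"
  obtains l :: "'a \<Rightarrow>\<^sub>L real" where "\<And>y. y \<in> S \<Longrightarrow> l y \<le> f y"
proof (cases "S = {}")
  case False
  \<comment> \<open>\<open>K\<close> may be negative, whereas sublinearity needs a nonnegative
    factor.\<close>
  define q where "q x = \<bar>K\<bar> * norm x" for x :: 'a
  have q: "sublinear q"
    unfolding sublinear_def q_def
    by (auto simp: distrib_left[symmetric] intro!: mult_left_mono norm_triangle_ineq)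
  have ql: "- q (- y) \<le> f y" if "y \<in> S" for y
    using le[OF that] mult_right_mono[OF abs_ge_self norm_ge_zero, of K y] by (simp add: q_def)
  obtain p where p: "sublinear p" "\<And>x. p x \<le> q x" "\<And>y. y \<in> S \<Longrightarrow> p y \<le> f y"
    using sublinear_minorant[OF q f False ql] by blast
  obtain l where l: "linear l" "\<And>x. l x \<le> p x"
    using linear_minorant[OF p(1)] by blast
  have "norm (l x) \<le> norm x * \<bar>K\<bar>" for x
  proof -
    have "l x \<le> \<bar>K\<bar> * norm x" "l (- x) \<le> \<bar>K\<bar> * norm x"
      using l(2)[of x] p(2)[of x] l(2)[of "- x"] p(2)[of "- x"] by (auto simp: q_def)
    then show ?thesis using linear_neg[OF l(1), of x] by (simp add: mult.commute)
  qed
  then have "bounded_linear l"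
    using l(1) by (intro bounded_linear_intro[of _ "\<bar>K\<bar>"]) (auto simp: linear_add linear_scale)
  then have "blinfun_apply (Blinfun l) y \<le> f y" if "y \<in> S" for y
    using l(2)[of y] p(3)[OF that] by (simp add: bounded_linear_Blinfun_apply)
  then show thesis by (rule that)
qed (use that in auto)


lemma separate_point_convex_cone:
  fixes w :: "'a::real_normed_vector"
  assumes "convex S" and cone: "\<And>c v. 0 \<le> c \<Longrightarrow> v \<in> S \<Longrightarrow> c *\<^sub>R v \<in> S" and "S \<noteq> {}"
    and "0 < d" and far: "\<And>v. v \<in> S \<Longrightarrow> d \<le> norm (v - w)"
  obtains l :: "'a \<Rightarrow>\<^sub>L real" where "\<And>v. v \<in> S \<Longrightarrow> l v \<le> 0" "0 < l w"
proof -
  \<comment> \<open>\<open>l \<le> - 1\<close> on \<open>S - w\<close> forces \<open>l \<le> 0\<close> on the cone \<open>S\<close> and \<open>l w \<ge> 1\<close>.\<close>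
  have cvx: "convex_on ((\<lambda>v. v - w) ` S) (\<lambda>_. - 1)"
    using \<open>convex S\<close> by (auto simp: convex_on_def convex_translation_subtract distrib_right[symmetric])
  \<comment> \<open>Points of \<open>S - w\<close> have norm at least \<open>d\<close>, so the slope
    1/d suffices.\<close>
  have low: "- (inverse d * norm y) \<le> - 1" if "y \<in> (\<lambda>v. v - w) ` S" for y
    using that far \<open>0 < d\<close> by (auto simp: field_simps)
  obtain l :: "'a \<Rightarrow>\<^sub>L real" where l: "\<And>y. y \<in> (\<lambda>v. v - w) ` S \<Longrightarrow> l y \<le> - 1"
    using blinfun_minorant[OF cvx low] by blast
  have l': "l v \<le> l w - 1" if "v \<in> S" for v
    using l[of "v - w"] that by (simp add: blinfun.diff_right)
  obtain v0 where "v0 \<in> S" using \<open>S \<noteq> {}\<close> by blast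
  then have "0 < l w" using l'[of 0] cone[of 0 v0] by simp
  moreover have "l v \<le> 0" if "v \<in> S" for v
  proof (rule ccontr)
    assume "\<not> l v \<le> 0"
    then have "l ((l w / l v) *\<^sub>R v) = l w" "0 \<le> l w / l v"
      using \<open>0 < l w\<close> by (auto simp: blinfun.scaleR_right)
    then show False using l'[OF cone[OF _ that], of "l w / l v"] by simp
  qed
  ultimately show thesis using that by blast
qed

section \<open>Lower semicontinuous convex functions at relative core points\<close>

text \<open>By Baire, one of the closed multiples of \<open>D\<close> that cover \<open>L\<close>
  has interior in \<open>L\<close>. Mixing the resulting ball in \<open>D\<close> with a point of
  \<open>D\<close> in the direction opposite to its centre moves the ball to the origin.\<close>

lemma absorbing_contains_ball:
  fixes D L :: "'a::banach set"
  assumes "subspace L" "closed L" "closed D" "convex D"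
    and absorb: "\<And>v. v \<in> L \<Longrightarrow> \<exists>t>0. t *\<^sub>R v \<in> D"
  obtains e where "0 < e" "\<And>v. v \<in> L \<Longrightarrow> norm v \<le> e \<Longrightarrow> v \<in> D"
proof -
  have "0 \<in> L" using \<open>subspace L\<close> by (rule subspace_0)
  have "0 \<in> D" using absorb[OF \<open>0 \<in> L\<close>] by simp
  define T where "T n = {v \<in> L. inverse (real (Suc n)) *\<^sub>R v \<in> D}" for n
  have T_closed: "closed (T n)" for n
  proof -
    have "closed ((\<lambda>v. inverse (real (Suc n)) *\<^sub>R v) -` D)"
      by (intro closed_vimage continuous_intros \<open>closed D\<close>)
    moreover have "T n = L \<inter> (\<lambda>v. inverse (real (Suc n)) *\<^sub>R v) -` D"
      by (auto simp: T_def)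
    ultimately show ?thesis using \<open>closed L\<close> by auto
  qed
  have "L \<subseteq> (\<Union>n. T n)"
  proof
    fix v assume "v \<in> L"
    then obtain t where t: "0 < t" "t *\<^sub>R v \<in> D" using absorb by blast
    obtain n where n: "inverse (real (Suc n)) < t" using reals_Archimedean[OF t(1)] by blast
    define s where "s = inverse (real (Suc n)) / t"
    have s: "0 \<le> s" "s \<le> 1" "s * t = inverse (real (Suc n))"
      using n t(1) by (auto simp: s_def field_simps)
    have "s *\<^sub>R (t *\<^sub>R v) + (1 - s) *\<^sub>R 0 \<in> D"
      using convexD[OF \<open>convex D\<close> t(2) \<open>0 \<in> D\<close>, of s "1 - s"] s by simp
    then have "inverse (real (Suc n)) *\<^sub>R v \<in> D" using s(3) by simp
    then show "v \<in> (\<Union>n. T n)" using \<open>v \<in> L\<close> by (auto simp: T_def)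
  qed
  then have UT: "(\<Union>n. T n) = L" by (auto simp: T_def)
  have "\<exists>n. top_of_set L interior_of T n \<noteq> {}"
  proof (rule ccontr)
    assume "\<not> ?thesis"
    then have "top_of_set L interior_of \<Union> (range T) = {}"
      using T_closed \<open>closed L\<close> completely_metrizable_space_euclidean
      by (intro Baire_category_alt)
         (auto simp: T_def closedin_closed_eq intro!: completely_metrizable_space_closedin)
    moreover have "top_of_set L interior_of L = L" by (simp add: interior_of_openin)
    ultimately show False using UT \<open>0 \<in> L\<close> by auto
  qed
  then obtain n a where "a \<in> top_of_set L interior_of T n" by blast
  then obtain U where U: "open U" "a \<in> U" "L \<inter> U \<subseteq> T n" "a \<in> L"
    by (auto simp: interior_of_def openin_open)
  obtain r where r: "0 < r" "cball a r \<subseteq> U" using U(1,2) open_contains_cball by blast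
  have ball: "inverse (real (Suc n)) *\<^sub>R (a + v) \<in> D" if "v \<in> L" "norm v \<le> r" for v
  proof -
    have "a + v \<in> cball a r" using that by (simp add: dist_norm)
    then have "a + v \<in> L \<inter> U" using r(2) U(4) that(1) \<open>subspace L\<close> by (auto intro: subspace_add)
    then show ?thesis using U(3) by (auto simp: T_def)
  qed
  have "- a \<in> L" using U(4) \<open>subspace L\<close> by (simp add: subspace_neg)
  then obtain s where s: "0 < s" "s *\<^sub>R (- a) \<in> D" using absorb by blast
  define N where "N = real (Suc n)"
  have N: "0 < N" by (simp add: N_def)
  \<comment> \<open>The weight solves \<open>\<alpha> / N = (1 - \<alpha>) * s\<close>, so that the
    multiples of \<open>a\<close> cancel in the convex combination below.\<close>
  define \<alpha> where "\<alpha> = s * N / (1 + s * N)"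
  have pos: "0 < 1 + s * N" using s N by (simp add: add_pos_pos)
  have \<alpha>: "0 < \<alpha>" "\<alpha> \<le> 1" "1 - \<alpha> = 1 / (1 + s * N)" "\<alpha> / N = s / (1 + s * N)"
  proof -
    show "0 < \<alpha>" using s(1) N pos by (simp add: \<alpha>_def)
    show "\<alpha> \<le> 1" using pos by (simp add: \<alpha>_def)
    show "1 - \<alpha> = 1 / (1 + s * N)" using pos by (simp add: \<alpha>_def field_simps)
    show "\<alpha> / N = s / (1 + s * N)" using N by (simp add: \<alpha>_def)
  qed
  show thesis
  proof (rule that)
    show "0 < \<alpha> / N * r" using \<alpha>(1) N r(1) by (intro mult_pos_pos divide_pos_pos)
    fix v assume v: "v \<in> L" "norm v \<le> \<alpha> / N * r"
    define u where "u = (N / \<alpha>) *\<^sub>R v"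
    have "u \<in> L" using v \<open>subspace L\<close> by (simp add: u_def subspace_scale)
    moreover have "norm u \<le> r"
      using mult_left_mono[OF v(2), of "N / \<alpha>"] \<alpha>(1) N by (simp add: u_def)
    ultimately have aD: "inverse N *\<^sub>R (a + u) \<in> D" using ball by (simp add: N_def)
    have "\<alpha> *\<^sub>R (inverse N *\<^sub>R (a + u)) + (1 - \<alpha>) *\<^sub>R (s *\<^sub>R (- a)) \<in> D"
      using \<alpha>(1,2) by (intro convexD[OF \<open>convex D\<close> aD s(2)]) auto
    moreover have "\<alpha> *\<^sub>R (inverse N *\<^sub>R (a + u)) + (1 - \<alpha>) *\<^sub>R (s *\<^sub>R (- a))
      = (\<alpha> / N) *\<^sub>R u + (\<alpha> / N - (1 - \<alpha>) * s) *\<^sub>R a"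
      by (simp add: algebra_simps divide_inverse)
    moreover have "\<alpha> / N - (1 - \<alpha>) * s = 0" unfolding \<alpha>(3,4) by simp
    moreover have "(\<alpha> / N) *\<^sub>R u = v" using \<alpha>(1) N by (simp add: u_def)
    ultimately show "v \<in> D" by simp
  qed
qed

section \<open>The algebraic interior of a convex set relative to a subspace of directions\<close>

definition relcore :: "'a::real_vector set \<Rightarrow> 'a set \<Rightarrow> 'a set" where
  "relcore L C = {x \<in> C. \<forall>v\<in>L. \<exists>t>0. x + t *\<^sub>R v \<in> C}"

text \<open>The homothety with centre \<open>y\<close> and ratio \<open>t\<close> maps
  \<open>C\<close> into itself and only rescales the room available at \<open>x\<close>.\<close>

lemma relcore_segment:
  assumes "convex C" "x \<in> relcore L C" "y \<in> C" "0 < t" "t \<le> 1"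
  shows "y + t *\<^sub>R (x - y) \<in> relcore L C"
proof -
  have conv: "y + t *\<^sub>R (u - y) \<in> C" if "u \<in> C" for u
    using convexD[OF \<open>convex C\<close> \<open>y \<in> C\<close> that, of "1 - t" t] assms(4,5) by (simp add: algebra_simps)
  have "\<exists>r>0. y + t *\<^sub>R (x - y) + r *\<^sub>R v \<in> C" if v: "v \<in> L" for v
  proof -
    obtain s where s: "0 < s" "x + s *\<^sub>R v \<in> C" using assms(2) v by (auto simp: relcore_def)
    then show ?thesis
      using conv[OF s(2)] \<open>0 < t\<close> by (intro exI[of _ "t * s"]) (simp add: algebra_simps)
  qed
  then show ?thesis using conv assms(2) by (auto simp: relcore_def)
qed

lemma closed_sublevel:
  fixes f :: "'a::metric_space \<Rightarrow> real"
  assumes "closed C" "lower_semicontinuous_on C f"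
  shows "closed {y \<in> C. f y \<le> r}"
  unfolding closed_sequential_limits
proof (intro allI impI)
  fix y x assume y: "(\<forall>n. y n \<in> {y \<in> C. f y \<le> r}) \<and> y \<longlonglongrightarrow> x"
  then have x: "x \<in> C" using \<open>closed C\<close> by (auto simp: closed_sequential_limits)
  show "x \<in> {y \<in> C. f y \<le> r}"
  proof (rule ccontr)
    assume "\<not> ?thesis"
    then have "r < f x" using x by simp
    then have "\<forall>\<^sub>F u in nhds x. u \<noteq> x \<longrightarrow> u \<in> C \<longrightarrow> r < f u"
      using assms(2) x by (simp add: lower_semicontinuous_on_def eventually_at_filter)
    \<comment> \<open>The punctured filter omits \<open>x\<close>, where the strict inequality holds
      by assumption.\<close>
    then have "\<forall>\<^sub>F u in nhds x. u \<in> C \<longrightarrow> r < f u"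
      by (rule eventually_mono) (use \<open>r < f x\<close> in blast)
    then have "\<forall>\<^sub>F n in sequentially. y n \<in> C \<longrightarrow> r < f (y n)"
      using y by (auto dest: eventually_compose_filterlim)
    then obtain n where "y n \<in> C \<longrightarrow> r < f (y n)"
      by (auto simp: eventually_sequentially)
    moreover have "y n \<in> C" "f (y n) \<le> r" using y by auto
    ultimately show False by simp
  qed
qed

text \<open>The sublevel set of \<open>f\<close> at height \<open>f x + 1\<close>, translated by
  \<open>- x\<close>, is closed and convex, and it absorbs \<open>L\<close> because \<open>f\<close>
  rises at most linearly along chords. Hence \<open>absorbing_contains_ball\<close> applies.\<close>

lemma bounded_near_relcore:
  fixes C L :: "'a::banach set"
  assumes L: "subspace L" "closed L" and "closed C" and f: "convex_on C f"
    and lsc: "lower_semicontinuous_on C f" and x: "x \<in> relcore L C"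
  obtains e where "0 < e" "\<And>v. v \<in> L \<Longrightarrow> norm v \<le> e \<Longrightarrow> x + v \<in> C \<and> f (x + v) \<le> f x + 1"
proof -
  let ?D = "(\<lambda>v. x + v) -` {y \<in> C. f y \<le> f x + 1}"
  have "closed ?D"
    by (intro closed_vimage closed_sublevel \<open>closed C\<close> lsc continuous_intros)
  moreover have "convex ?D"
  proof (rule convexI)
    fix v w :: 'a and s t :: real
    assume vw: "v \<in> ?D" "w \<in> ?D" and st: "0 \<le> s" "0 \<le> t" "s + t = 1"
    have eq: "x + (s *\<^sub>R v + t *\<^sub>R w) = s *\<^sub>R (x + v) + t *\<^sub>R (x + w)"
      using st(3) by (simp add: algebra_simps flip: scaleR_add_left)
    have "f (s *\<^sub>R (x + v) + t *\<^sub>R (x + w)) \<le> s * f (x + v) + t * f (x + w)"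
      by (rule convex_onD'[OF f]) (use vw st in auto)
    also have "\<dots> \<le> s * (f x + 1) + t * (f x + 1)"
      using vw st by (intro add_mono mult_left_mono) auto
    also have "\<dots> = f x + 1" using st(3) by (simp flip: distrib_right)
    finally show "s *\<^sub>R v + t *\<^sub>R w \<in> ?D"
      using convexD[OF convex_on_imp_convex[OF f], of "x + v" "x + w" s t] vw st by (simp add: eq)
  qed
  moreover have "\<exists>t>0. t *\<^sub>R v \<in> ?D" if "v \<in> L" for v
  proof -
    obtain s where s: "0 < s" "x + s *\<^sub>R v \<in> C" using x \<open>v \<in> L\<close> by (auto simp: relcore_def)
    define a where "a = f (x + s *\<^sub>R v) - f x"
    \<comment> \<open>Chosen so that both \<open>t\<close> and \<open>t * a\<close> are at most
      1.\<close>
    define t where "t = inverse (1 + \<bar>a\<bar>)"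
    have t: "0 < t" "t \<le> 1" "t * a \<le> 1" by (auto simp: t_def field_simps)
    have xC: "x \<in> C" using x by (simp add: relcore_def)
    have eq: "(1 - t) *\<^sub>R x + t *\<^sub>R (x + s *\<^sub>R v) = x + (t * s) *\<^sub>R v"
      by (simp add: algebra_simps)
    have "f (x + (t * s) *\<^sub>R v) \<le> (1 - t) * f x + t * f (x + s *\<^sub>R v)"
      using convex_onD'[OF f xC s(2), of "1 - t" t] t(1,2) unfolding eq by simp
    also have "\<dots> = f x + t * a" by (simp add: a_def algebra_simps)
    finally have "f (x + (t * s) *\<^sub>R v) \<le> f x + 1" using t(3) by simp
    moreover have "x + (t * s) *\<^sub>R v \<in> C"
      using convexD[OF convex_on_imp_convex[OF f] xC s(2), of "1 - t" t] t(1,2) by (simp add: eq)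
    ultimately show ?thesis using s t(1) by (intro exI[of _ "t * s"]) simp
  qed
  ultimately obtain e where "0 < e" "\<And>v. v \<in> L \<Longrightarrow> norm v \<le> e \<Longrightarrow> v \<in> ?D"
    using absorbing_contains_ball[OF L, of ?D] by blast
  then show thesis using that by auto
qed

text \<open>Moving \<open>x\<close> to the origin and \<open>f x\<close> to zero turns calmness into
  the hypothesis of \<open>blinfun_minorant\<close>.\<close>

lemma calm_imp_subgradient:
  fixes f :: "'a::real_normed_vector \<Rightarrow> real"
  assumes f: "convex_on C f" and calm: "\<And>y. y \<in> C \<Longrightarrow> - (K * norm (y - x)) \<le> f y - f x"
  obtains l :: "'a \<Rightarrow>\<^sub>L real" where "\<And>y. y \<in> C \<Longrightarrow> l (y - x) \<le> f y - f x"
proof -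
  let ?S = "(\<lambda>y. y - x) ` C" and ?g = "\<lambda>v. f (v + x) - f x"
  have "convex_on ?S ?g"
    unfolding convex_on_def
  proof (intro conjI ballI allI impI)
    show "convex ?S" using convex_on_imp_convex[OF f] by (simp add: convex_translation_subtract)
    fix v w :: 'a and s t :: real
    assume vw: "v \<in> ?S" "w \<in> ?S" and st: "0 \<le> s" "0 \<le> t" "s + t = 1"
    have eq: "s *\<^sub>R v + t *\<^sub>R w + x = s *\<^sub>R (v + x) + t *\<^sub>R (w + x)"
      using st(3) by (simp add: algebra_simps flip: scaleR_add_left)
    have "f (s *\<^sub>R (v + x) + t *\<^sub>R (w + x)) \<le> s * f (v + x) + t * f (w + x)"
      by (rule convex_onD'[OF f]) (use vw st in auto)
    moreover have "s * f x + t * f x = f x" using st(3) by (simp flip: distrib_right)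
    ultimately show "?g (s *\<^sub>R v + t *\<^sub>R w) \<le> s * ?g v + t * ?g w"
      unfolding eq right_diff_distrib by linarith
  qed
  moreover have "- (K * norm v) \<le> ?g v" if "v \<in> ?S" for v
    using that calm by auto
  ultimately obtain l :: "'a \<Rightarrow>\<^sub>L real" where "\<And>v. v \<in> ?S \<Longrightarrow> l v \<le> ?g v"
    using blinfun_minorant[of ?S ?g K] by blast
  then show thesis using that[of l] by force
qed

text \<open>An upper bound on a relative ball of radius \<open>e\<close> gives calmness with
  constant 1/e: \<open>x\<close> lies between \<open>y\<close> and a point at distance
  \<open>e\<close> on the opposite side, and convexity along this chord bounds \<open>f y\<close>
  from below.\<close>

lemma subgradient_at_relcore:
  fixes C L :: "'a::banach set"
  assumes L: "subspace L" "closed L" and "closed C" and f: "convex_on C f"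
    and lsc: "lower_semicontinuous_on C f" and x: "x \<in> relcore L C"
    and CL: "\<And>y. y \<in> C \<Longrightarrow> y - x \<in> L"
  obtains l :: "'a \<Rightarrow>\<^sub>L real" where "\<And>y. y \<in> C \<Longrightarrow> l (y - x) \<le> f y - f x"
proof -
  obtain e where e: "0 < e" "\<And>v. v \<in> L \<Longrightarrow> norm v \<le> e \<Longrightarrow> x + v \<in> C \<and> f (x + v) \<le> f x + 1"
    using bounded_near_relcore[OF L \<open>closed C\<close> f lsc x] by blast
  have "- (inverse e * norm (y - x)) \<le> f y - f x" if y: "y \<in> C" for y
  proof (cases "y = x")
    case False
    define n where "n = norm (y - x)"
    have n: "0 < n" using False by (simp add: n_def)
    define w where "w = - (e / n) *\<^sub>R (y - x)"
    have "w \<in> L" using CL[OF y] L(1) by (simp add: w_def subspace_scale subspace_neg)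
    moreover have "norm w \<le> e" using n e by (simp add: w_def n_def)
    ultimately have w: "x + w \<in> C" "f (x + w) \<le> f x + 1" using e by auto
    \<comment> \<open>The weights for which \<open>s *\<^sub>R (y - x) + t *\<^sub>R w\<close>
      vanishes.\<close>
    define s where "s = e / (n + e)"
    define t where "t = n / (n + e)"
    have st: "0 \<le> s" "0 \<le> t" "s + t = 1" "s - t * (e / n) = 0"
      using n e(1) by (auto simp: s_def t_def add.commute simp flip: add_divide_distrib)
    have "s *\<^sub>R y + t *\<^sub>R (x + w) = (s + t) *\<^sub>R x + (s - t * (e / n)) *\<^sub>R (y - x)"
      by (simp add: w_def algebra_simps)
    then have "f x \<le> s * f y + t * f (x + w)"
      using convex_onD'[OF f y w(1) st(1-3)] st(3,4) by simp
    also have "\<dots> \<le> s * f y + t * (f x + 1)" using w st by (simp add: mult_left_mono)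
    finally have "(n + e) * f x \<le> (n + e) * (s * f y + t * (f x + 1))"
      using n e by simp
    also have "\<dots> = e * f y + n * (f x + 1)"
      using n e by (simp add: s_def t_def distrib_left)
    finally have "- n \<le> e * (f y - f x)" by (simp add: algebra_simps)
    then show ?thesis using e by (simp add: field_simps n_def)
  qed simp
  then show thesis using calm_imp_subgradient[OF f] that by blast
qed


section \<open>Equality of the two operators\<close>

lemma usc_limit:
  assumes usc: "upper_semicontinuous_on C f" and "x \<in> C" and g: "(g \<longlongrightarrow> x) G" and "G \<noteq> bot"
    and h: "(h \<longlongrightarrow> c) G" and le: "\<forall>\<^sub>F t in G. g t \<in> C \<and> h t \<le> f (g t)"
  shows "c \<le> f x"
proof (rule ccontr)
  assume "\<not> ?thesis"
  then obtain r where r: "f x < r" "r < c" using dense[of "f x" c] by auto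
  then have "\<forall>\<^sub>F u in nhds x. u \<noteq> x \<longrightarrow> u \<in> C \<longrightarrow> f u < r"
    using usc \<open>x \<in> C\<close> by (simp add: upper_semicontinuous_on_def eventually_at_filter)
  then have "\<forall>\<^sub>F u in nhds x. u \<in> C \<longrightarrow> f u < r"
    by (rule eventually_mono) (use r(1) in blast)
  then have "\<forall>\<^sub>F t in G. g t \<in> C \<longrightarrow> f (g t) < r"
    using g by (rule eventually_compose_filterlim)
  moreover have "\<forall>\<^sub>F t in G. r < h t" using h r(2) by (rule order_tendstoD)
  ultimately have "\<forall>\<^sub>F t in G. False"
    using le by eventually_elim auto
  then show False using \<open>G \<noteq> bot\<close> by simp
qed

text \<open>Every later limit in the first argument of a bifunction has this form: a bound known
  inside a segment is carried to its endpoint \<open>x\<close>.\<close>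

lemma usc_limit_segment:
  fixes x y :: "'a::real_normed_vector"
  assumes "upper_semicontinuous_on C f" "x \<in> C" "(h \<longlongrightarrow> c) (at_right 0)"
    and le: "\<And>t. 0 < t \<Longrightarrow> t < 1 \<Longrightarrow> x + t *\<^sub>R (y - x) \<in> C \<and> h t \<le> f (x + t *\<^sub>R (y - x))"
  shows "c \<le> f x"
proof (rule usc_limit[OF assms(1,2) _ _ assms(3)])
  show "((\<lambda>t. x + t *\<^sub>R (y - x)) \<longlongrightarrow> x) (at_right 0)"
    by (rule tendsto_eq_intros | simp)+
  show "\<forall>\<^sub>F t in at_right 0. x + t *\<^sub>R (y - x) \<in> C \<and> h t \<le> f (x + t *\<^sub>R (y - x))"
    using le by (auto simp: eventually_at_right_field intro: exI[of _ 1])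
qed simp

lemma convex_segment:
  assumes "convex C" "x \<in> C" "y \<in> C" "0 \<le> t" "t \<le> 1"
  shows "x + t *\<^sub>R (y - x) \<in> C"
  using convexD[OF assms(1-3), of "1 - t" t] assms(4,5) by (simp add: algebra_simps)

lemma upper_semicontinuous_on_minus:
  assumes "lower_semicontinuous_on S f"
  shows "upper_semicontinuous_on S (\<lambda>x. - f x)"
  unfolding upper_semicontinuous_on_def
proof (intro ballI allI impI)
  fix x r assume "x \<in> S" "- f x < r"
  then have "\<forall>\<^sub>F y in at x within S. - r < f y"
    using assms by (simp add: lower_semicontinuous_on_def minus_less_iff)
  then show "\<forall>\<^sub>F y in at x within S. - f y < r"
    by eventually_elim simp
qed

text \<open>At \<open>u\<close> on the segment, convexity bounds \<open>F u u = 0\<close> by a mean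
  of \<open>F u x\<close> and \<open>F u y\<close>. The left operator controls \<open>F u x\<close>;
  dividing by \<open>t\<close> and letting \<open>u\<close> tend to \<open>x\<close> leaves the
  bound on \<open>F x y\<close>.\<close>

lemma bifun_op_left_subset:
  assumes diag: "\<And>x. x \<in> C \<Longrightarrow> F x x = 0"
    and cvx: "\<And>x. x \<in> C \<Longrightarrow> convex_on C (\<lambda>y. F x y)"
    and usc: "\<And>y. y \<in> C \<Longrightarrow> upper_semicontinuous_on C (\<lambda>x. F x y)"
  shows "bifun_op_left C F x \<subseteq> bifun_op C F x"
proof
  fix xs assume xs: "xs \<in> bifun_op_left C F x"
  then have x: "x \<in> C" by (auto simp: bifun_op_left_def split: if_splits)
  have le: "F y x \<le> - xs (y - x)" if "y \<in> C" for y
    using xs x that diag[OF x] by (force simp: bifun_op_left_def)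
  have "xs (y - x) \<le> F x y" if y: "y \<in> C" for y
  proof (rule usc_limit_segment[OF usc[OF y] x])
    show "((\<lambda>t. (1 - t) * xs (y - x)) \<longlongrightarrow> xs (y - x)) (at_right 0)"
      by (rule tendsto_eq_intros | simp)+
    fix t :: real assume t: "0 < t" "t < 1"
    define u where "u = x + t *\<^sub>R (y - x)"
    have u: "u \<in> C"
      using convex_segment[OF convex_on_imp_convex[OF cvx[OF x]] x y] t by (simp add: u_def)
    have u': "u = (1 - t) *\<^sub>R x + t *\<^sub>R y" by (simp add: u_def algebra_simps)
    have "0 \<le> (1 - t) * F u x + t * F u y"
      using convex_onD'[OF cvx[OF u] x y, of "1 - t" t] t diag[OF u] by (simp flip: u')
    also have "\<dots> \<le> (1 - t) * - (t * xs (y - x)) + t * F u y"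
      using le[OF u] t by (intro add_right_mono mult_left_mono) (auto simp: u_def blinfun.scaleR_right)
    finally have "t * ((1 - t) * xs (y - x)) \<le> t * F u y" by (simp add: algebra_simps)
    then have "(1 - t) * xs (y - x) \<le> F u y" using t by simp
    then show "x + t *\<^sub>R (y - x) \<in> C \<and> (1 - t) * xs (y - x) \<le> F (x + t *\<^sub>R (y - x)) y"
      using u by (simp add: u_def)
  qed
  then show "xs \<in> bifun_op C F x" using x diag[OF x] by (simp add: bifun_op_def)
qed

text \<open>Passing from \<open>F x y\<close> to \<open>- F y x\<close> exchanges the two operators
  and preserves the hypotheses, so one inclusion yields the other.\<close>

lemma bifun_op_eq_bifun_op_left:
  assumes "\<And>x. x \<in> C \<Longrightarrow> F x x = 0"
    and "\<And>x. x \<in> C \<Longrightarrow> convex_on C (\<lambda>y. F x y)"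
    and "\<And>x. x \<in> C \<Longrightarrow> lower_semicontinuous_on C (\<lambda>y. F x y)"
    and "\<And>y. y \<in> C \<Longrightarrow> concave_on C (\<lambda>x. F x y)"
    and "\<And>y. y \<in> C \<Longrightarrow> upper_semicontinuous_on C (\<lambda>x. F x y)"
  shows "bifun_op C F = bifun_op_left C F"
proof
  fix x
  let ?G = "\<lambda>x y. - F y x"
  have "upper_semicontinuous_on C (\<lambda>x. ?G x y)" if "y \<in> C" for y
    using assms(3)[OF that] by (rule upper_semicontinuous_on_minus)
  then have "bifun_op_left C ?G x \<subseteq> bifun_op C ?G x"
    using assms(1,4) by (intro bifun_op_left_subset) (auto simp: concave_on_def)
  moreover have "bifun_op_left C ?G x = bifun_op C F x" "bifun_op C ?G x = bifun_op_left C F x"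
    by (auto simp: bifun_op_left_def bifun_op_def)
  moreover have "bifun_op_left C F x \<subseteq> bifun_op C F x"
    using assms by (intro bifun_op_left_subset) auto
  ultimately show "bifun_op C F x = bifun_op_left C F x" by simp
qed

text \<open>Reading \<open>ys\<close> in the left operator makes both inequalities concern the same
  number \<open>F x y\<close>; they add up to monotonicity.\<close>

lemma monotone_bifun_op:
  assumes eq: "bifun_op C F = bifun_op_left C F" and diag: "\<And>x. x \<in> C \<Longrightarrow> F x x = 0"
  shows "monotone_operator (bifun_op C F)"
  unfolding monotone_operator_def
proof (intro allI ballI)
  fix x y xs ys assume xs: "xs \<in> bifun_op C F x" and ys: "ys \<in> bifun_op C F y"
  then have xy: "x \<in> C" "y \<in> C" by (auto simp: bifun_op_def split: if_splits)
  have "xs (y - x) \<le> F x y" using xs xy diag by (force simp: bifun_op_def)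
  moreover have "ys (x - y) \<le> - F x y"
    using ys xy diag unfolding eq by (force simp: bifun_op_left_def)
  moreover have "ys (x - y) = - ys (y - x)" by (simp add: blinfun.diff_right)
  ultimately show "0 \<le> (ys - xs) (y - x)" by (simp add: blinfun.diff_left)
qed

section \<open>Maximality\<close>

text \<open>Here \<open>L\<close> stands for the closed subspace \<open>cone (C - x0)\<close>; the
  assumptions keep only that it contains all differences of points of \<open>C\<close> and that
  \<open>C\<close> absorbs it at \<open>x0\<close>.\<close>

locale saddle_bifunction =
  fixes C L :: "'a::banach set" and F :: "'a \<Rightarrow> 'a \<Rightarrow> real" and x0 :: 'a
  assumes L: "subspace L" "closed L" and C: "closed C" and x0: "x0 \<in> relcore L C"
    and diff_L: "\<And>x y. x \<in> C \<Longrightarrow> y \<in> C \<Longrightarrow> x - y \<in> L"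
    and diag: "\<And>x. x \<in> C \<Longrightarrow> F x x = 0"
    and cvx: "\<And>x. x \<in> C \<Longrightarrow> convex_on C (\<lambda>y. F x y)"
    and lsc: "\<And>x. x \<in> C \<Longrightarrow> lower_semicontinuous_on C (\<lambda>y. F x y)"
    and ccv: "\<And>y. y \<in> C \<Longrightarrow> concave_on C (\<lambda>x. F x y)"
    and usc: "\<And>y. y \<in> C \<Longrightarrow> upper_semicontinuous_on C (\<lambda>x. F x y)"
begin

lemma x0_in: "x0 \<in> C" using x0 by (simp add: relcore_def)

lemma convex_C: "convex C" using convex_on_imp_convex[OF cvx[OF x0_in]] .

lemma in_bifun_op_iff: "xs \<in> bifun_op C F x \<longleftrightarrow> x \<in> C \<and> (\<forall>y\<in>C. xs (y - x) \<le> F x y)"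
  using diag by (auto simp: bifun_op_def)

text \<open>Since \<open>F x x = 0\<close>, the values of the operator at \<open>x\<close> are the
  subgradients of \<open>F x\<close> at \<open>x\<close>.\<close>

lemma bifun_op_nonempty:
  assumes "x \<in> relcore L C"
  obtains xs where "xs \<in> bifun_op C F x"
proof -
  have x: "x \<in> C" using assms by (simp add: relcore_def)
  show thesis
    using subgradient_at_relcore[OF L C cvx[OF x] lsc[OF x] assms] diff_L x diag that in_bifun_op_iff
    by (metis diff_zero)
qed

section \<open>Pairs monotonically related to the graph\<close>

context
  fixes z :: 'a and zs :: "'a \<Rightarrow>\<^sub>L real"
  assumes related: "\<And>x xs. xs \<in> bifun_op C F x \<Longrightarrow> 0 \<le> (zs - xs) (z - x)"
begin

lemma related_in_domain:
  assumes z: "z \<in> C"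
  shows "zs \<in> bifun_op C F z"
  unfolding in_bifun_op_iff
proof (intro conjI ballI z)
  have core: "zs (y - z) \<le> F z y" if y: "y \<in> relcore L C" for y
  proof (rule usc_limit_segment[OF usc z])
    show yC: "y \<in> C" using y by (simp add: relcore_def)
    show "((\<lambda>t. (1 - t) * zs (y - z)) \<longlongrightarrow> zs (y - z)) (at_right 0)"
      by (rule tendsto_eq_intros | simp)+
    fix t :: real assume t: "0 < t" "t < 1"
    define u where "u = z + t *\<^sub>R (y - z)"
    have u: "u \<in> relcore L C"
      using relcore_segment[OF convex_C y z] t by (simp add: u_def)
    obtain us where us: "us \<in> bifun_op C F u" using bifun_op_nonempty[OF u] .
    \<comment> \<open>As \<open>z - u\<close> is a negative multiple of \<open>y - z\<close>,
      relatedness at \<open>u\<close> compares \<open>zs\<close> with \<open>us\<close> in the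
      direction \<open>y - z\<close>.\<close>
    have "z - u = - (t *\<^sub>R (y - z))" by (simp add: u_def)
    then have "(zs - us) (z - u) = t * (us (y - z) - zs (y - z))"
      by (simp only: blinfun.diff_left blinfun.minus_right blinfun.scaleR_right) (simp add: right_diff_distrib)
    then have "zs (y - z) \<le> us (y - z)"
      using related[OF us] t by (simp add: zero_le_mult_iff)
    then have "(1 - t) * zs (y - z) \<le> (1 - t) * us (y - z)" using t by simp
    also have "\<dots> = us ((1 - t) *\<^sub>R (y - z))" by (simp add: blinfun.scaleR_right)
    also have "(1 - t) *\<^sub>R (y - z) = y - u" by (simp add: u_def algebra_simps)
    also have "us (y - u) \<le> F u y" using us yC by (simp add: in_bifun_op_iff)
    finally show "z + t *\<^sub>R (y - z) \<in> C \<and> (1 - t) * zs (y - z) \<le> F (z + t *\<^sub>R (y - z)) y"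
      using u by (simp add: u_def relcore_def)
  qed
  \<comment> \<open>A general \<open>y\<close> is approached by core points on the segment to
    \<open>x0\<close>, where convexity of \<open>F z\<close> supplies an affine upper bound.\<close>
  fix y assume y: "y \<in> C"
  show "zs (y - z) \<le> F z y"
  proof (rule tendsto_le[OF trivial_limit_at_right_real])
    show "((\<lambda>t. (1 - t) * F z y + t * F z x0) \<longlongrightarrow> F z y) (at_right 0)"
      by (rule tendsto_eq_intros | simp)+
    show "((\<lambda>t. zs (y - z) + t * zs (x0 - y)) \<longlongrightarrow> zs (y - z)) (at_right 0)"
      by (rule tendsto_eq_intros | simp)+
    have "zs (y - z) + t * zs (x0 - y) \<le> (1 - t) * F z y + t * F z x0" if t: "0 < t" "t < 1" for t
    proof -
      have "zs (y - z) + t * zs (x0 - y) = zs (y + t *\<^sub>R (x0 - y) - z)"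
        by (simp add: blinfun.diff_right blinfun.add_right blinfun.scaleR_right)
      also have "\<dots> \<le> F z (y + t *\<^sub>R (x0 - y))"
        using core relcore_segment[OF convex_C x0 y] t by simp
      also have "y + t *\<^sub>R (x0 - y) = (1 - t) *\<^sub>R y + t *\<^sub>R x0" by (simp add: algebra_simps)
      also have "F z ((1 - t) *\<^sub>R y + t *\<^sub>R x0) \<le> (1 - t) * F z y + t * F z x0"
        using convex_onD'[OF cvx[OF z] y x0_in] t by simp
      finally show ?thesis .
    qed
    then show "\<forall>\<^sub>F t in at_right 0. zs (y - z) + t * zs (x0 - y) \<le> (1 - t) * F z y + t * F z x0"
      by (auto simp: eventually_at_right_field intro: exI[of _ 1])
  qed
qed

text \<open>For \<open>p\<close> between \<open>b\<close> and \<open>x0\<close>, every value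
  \<open>ps\<close> at \<open>p\<close> is bounded by one constant \<open>B\<close> on the ball of
  radius \<open>e\<close> in \<open>L\<close>. So \<open>F p\<close> decays at most with slope B/e,
  and upper semicontinuity carries this to \<open>b\<close>.\<close>

lemma calm_on_segment:
  assumes \<tau>: "0 \<le> \<tau>" "\<tau> < 1" and b_def: "b = x0 + \<tau> *\<^sub>R (z - x0)" and b: "b \<in> C"
  obtains K where "\<And>y. y \<in> C \<Longrightarrow> - (K * norm (y - b)) \<le> F b y"
proof -
  obtain e where e: "0 < e"
    and ball: "\<And>v. v \<in> L \<Longrightarrow> norm v \<le> e \<Longrightarrow> x0 + v \<in> C \<and> F x0 (x0 + v) \<le> F x0 x0 + 1"
    using bounded_near_relcore[OF L C cvx[OF x0_in] lsc[OF x0_in] x0] by metis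
  have "- (b - x0) \<in> L" using diff_L[OF x0_in b] by simp
  then obtain \<eta> where \<eta>: "0 < \<eta>" "x0 + \<eta> *\<^sub>R - (b - x0) \<in> C"
    using x0 unfolding relcore_def by blast
  \<comment> \<open>\<open>u\<close> lies beyond \<open>x0\<close> as seen from \<open>b\<close>: concavity of \<open>F\<close> in its first argument then bounds
    \<open>F p\<close> near \<open>x0\<close> uniformly for \<open>p\<close> between \<open>b\<close> and \<open>x0\<close>.\<close>
  define u where "u = x0 - \<eta> *\<^sub>R (b - x0)"
  have u: "u \<in> C" using \<eta>(2) by (simp add: u_def algebra_simps)
  obtain l :: "'a \<Rightarrow>\<^sub>L real" where l: "\<And>y. y \<in> C \<Longrightarrow> l (y - x0) \<le> F u y - F u x0"
    using subgradient_at_relcore[OF L C cvx[OF u] lsc[OF u] x0] diff_L x0_in by blast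
  \<comment> \<open>The affine minorant of \<open>F u\<close> at \<open>x0\<close> bounds
    \<open>F u\<close> from below by \<open>- M\<close> on the ball.\<close>
  define M where "M = \<bar>F u x0\<bar> + norm l * e"
  have M: "0 \<le> M" using e by (simp add: M_def)
  have Fu: "- M \<le> F u (x0 + v)" if v: "v \<in> L" "norm v \<le> e" for v
  proof -
    have "\<bar>l v\<bar> \<le> norm l * e"
      using norm_blinfun[of l v] mult_left_mono[OF v(2) norm_ge_zero[of l]] by simp
    then show ?thesis using l[of "x0 + v"] ball[OF v] by (simp add: M_def)
  qed
  define B where "B = (\<eta> + 1 + M) / \<eta> + \<bar>zs (z - x0)\<bar>"
  have "- (B / e * norm (y - b)) \<le> F b y" if y: "y \<in> C" for y
  proof (rule usc_limit_segment[OF usc[OF y] b])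
    show "((\<lambda>t. - (B / e * norm (y - (b + t *\<^sub>R (x0 - b))))) \<longlongrightarrow> - (B / e * norm (y - b))) (at_right 0)"
      by (rule tendsto_eq_intros | simp)+
    fix t :: real assume t: "0 < t" "t < 1"
    define p where "p = b + t *\<^sub>R (x0 - b)"
    have p: "p \<in> relcore L C" unfolding p_def using relcore_segment[OF convex_C x0 b] t by simp
    then have pC: "p \<in> C" by (simp add: relcore_def)
    obtain ps where ps: "ps \<in> bifun_op C F p" using bifun_op_nonempty[OF p] .
    have upper: "F p (x0 + v) \<le> (\<eta> + 1 + M) / \<eta>" if v: "v \<in> L" "norm v \<le> e" for v
    proof -
      \<comment> \<open>\<open>x0\<close> is the mean of \<open>p\<close> and \<open>u\<close> with
        weights \<open>\<eta> / k\<close> and \<open>(1 - t) / k\<close>.\<close>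
      define k where "k = \<eta> + (1 - t)"
      have k: "0 < k" using \<eta> t by (simp add: k_def)
      have vC: "x0 + v \<in> C" using ball[OF v] by simp
      have w: "0 \<le> \<eta> / k" "0 \<le> (1 - t) / k" "\<eta> / k + (1 - t) / k = 1"
        using \<eta> t k by (auto simp: k_def simp flip: add_divide_distrib)
      have "k *\<^sub>R ((\<eta> / k) *\<^sub>R p + ((1 - t) / k) *\<^sub>R u) = k *\<^sub>R x0"
        using k by (simp add: scaleR_add_right) (simp add: p_def u_def k_def algebra_simps)
      then have eq: "(\<eta> / k) *\<^sub>R p + ((1 - t) / k) *\<^sub>R u = x0" using k by simp
      have "\<eta> / k * F p (x0 + v) + (1 - t) / k * F u (x0 + v) \<le> F x0 (x0 + v)"
        using convex_onD'[OF ccv[OF vC, unfolded concave_on_def] pC u w] by (simp add: eq)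
      also have "\<dots> \<le> 1" using ball[OF v] diag[OF x0_in] by simp
      finally have "k * (\<eta> / k * F p (x0 + v) + (1 - t) / k * F u (x0 + v)) \<le> k * 1"
        using k by (intro mult_left_mono) auto
      then have "\<eta> * F p (x0 + v) + (1 - t) * F u (x0 + v) \<le> k"
        using k by (simp add: distrib_left)
      moreover have "- M \<le> (1 - t) * F u (x0 + v)"
      proof -
        have "(1 - t) * - M \<le> (1 - t) * F u (x0 + v)"
          using Fu[OF v] t by (intro mult_left_mono) auto
        moreover have "(1 - t) * M \<le> 1 * M" using M t by (intro mult_right_mono) auto
        ultimately show ?thesis by simp
      qed
      ultimately have "\<eta> * F p (x0 + v) \<le> \<eta> + 1 + M" using t by (simp add: k_def)
      then show ?thesis using \<eta> by (simp add: field_simps)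
    qed
    \<comment> \<open>\<open>z - p\<close> is a positive multiple of \<open>z - x0\<close> and
      \<open>x0 - p\<close> a nonpositive one, so relatedness bounds \<open>ps (x0 - p)\<close> from
      below.\<close>
    have lower: "- \<bar>zs (z - x0)\<bar> \<le> ps (x0 - p)"
    proof -
      define c where "c = (1 - t) * \<tau>"
      have c: "0 \<le> c" "c < 1"
        using t \<tau> mult_strict_mono'[of "1 - t" 1 \<tau> 1] by (auto simp: c_def)
      have zp: "z - p = (1 - c) *\<^sub>R (z - x0)" and xp: "x0 - p = - (c *\<^sub>R (z - x0))"
        by (simp_all add: p_def b_def c_def algebra_simps)
      have "ps (z - x0) \<le> zs (z - x0)"
        using related[OF ps] c
        by (simp add: zp blinfun.diff_left blinfun.scaleR_right zero_le_mult_iff)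
      then have "c * ps (z - x0) \<le> c * \<bar>zs (z - x0)\<bar>" using c by (intro mult_left_mono) auto
      also have "\<dots> \<le> \<bar>zs (z - x0)\<bar>" using c by (intro mult_left_le_one_le) auto
      finally show ?thesis by (simp add: xp blinfun.minus_right blinfun.scaleR_right)
    qed
    have bound: "ps v \<le> B" if v: "v \<in> L" "norm v \<le> e" for v
    proof -
      have "ps (x0 + v - p) \<le> F p (x0 + v)"
        using ps ball[OF v] by (simp add: in_bifun_op_iff)
      moreover have "ps (x0 + v - p) = ps (x0 - p) + ps v"
        by (simp add: blinfun.diff_right blinfun.add_right)
      ultimately show ?thesis using upper[OF v] lower by (simp add: B_def)
    qed
    have "- (B / e * norm (y - p)) \<le> ps (y - p)"
    proof (cases "y = p")
      case False
      \<comment> \<open>A vector of norm \<open>e\<close> opposite to \<open>y - p\<close> turns the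
        upper bound for \<open>ps\<close> on the ball into a lower bound at
        \<open>y - p\<close>.\<close>
      define v where "v = - (e / norm (y - p)) *\<^sub>R (y - p)"
      have "v \<in> L" using diff_L[OF y pC] L(1) by (simp add: v_def subspace_scale subspace_neg)
      moreover have "norm v \<le> e" using e False by (simp add: v_def)
      ultimately have "ps v \<le> B" by (rule bound)
      moreover have "ps v = - (e / norm (y - p)) * ps (y - p)"
        unfolding v_def blinfun.scaleR_right by simp
      ultimately show ?thesis using e False by (simp add: field_simps)
    qed simp
    also have "\<dots> \<le> F p y" using ps y by (simp add: in_bifun_op_iff)
    finally show "b + t *\<^sub>R (x0 - b) \<in> C \<and> - (B / e * norm (y - (b + t *\<^sub>R (x0 - b)))) \<le> F (b + t *\<^sub>R (x0 - b)) y"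
      using pC by (simp add: p_def)
  qed
  then show thesis by (rule that)
qed

end

text \<open>If \<open>z - x0\<close> is outside \<open>L\<close>, then \<open>z - b\<close> is
  separated from \<open>L\<close> itself, which contains \<open>C - b\<close>. Otherwise it is
  separated from the cone generated by \<open>C - b\<close>.\<close>

lemma normal_at_last_point:
  assumes \<tau>: "0 \<le> \<tau>" "\<tau> < 1" and b_def: "b = x0 + \<tau> *\<^sub>R (z - x0)" and b: "b \<in> C"
    and last: "\<And>\<sigma>. \<tau> < \<sigma> \<Longrightarrow> \<sigma> \<le> 1 \<Longrightarrow> x0 + \<sigma> *\<^sub>R (z - x0) \<notin> C"
  obtains l :: "'a \<Rightarrow>\<^sub>L real" where "\<And>y. y \<in> C \<Longrightarrow> l (y - b) \<le> 0" "0 < l (z - b)"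
proof (cases "z - x0 \<in> L")
  case False
  have zb: "z - b = (1 - \<tau>) *\<^sub>R (z - x0)" by (simp add: b_def algebra_simps)
  have "z - b \<notin> L"
    using False subspace_scale[OF L(1), of "(1 - \<tau>) *\<^sub>R (z - x0)" "inverse (1 - \<tau>)"] \<tau> by (auto simp: zb)
  then obtain d where d: "0 < d" "ball (z - b) d \<subseteq> - L"
    using L(2) by (metis ComplI open_Compl open_contains_ball)
  have "d \<le> norm (v - (z - b))" if "v \<in> L" for v
    using that d(2) by (force simp: dist_norm norm_minus_commute not_less)
  moreover have "convex L" "L \<noteq> {}" using L(1) subspace_0 by (auto simp: subspace_imp_convex)
  ultimately obtain l :: "'a \<Rightarrow>\<^sub>L real" where "\<And>v. v \<in> L \<Longrightarrow> l v \<le> 0" "0 < l (z - b)"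
    using separate_point_convex_cone[of L d "z - b"] L(1) d(1) by (metis subspace_scale)
  then show thesis using that diff_L b by blast
next
  case True
  define w where "w = z - b"
  have w: "w = (1 - \<tau>) *\<^sub>R (z - x0)" by (simp add: w_def b_def algebra_simps)
  have "w \<in> L" using True L(1) by (simp add: w subspace_scale)
  have "z \<noteq> b" using last[of 1] \<tau> b by auto
  then have "w \<noteq> 0" by (simp add: w_def)
  obtain e where e: "0 < e" and "\<And>v. v \<in> L \<Longrightarrow> norm v \<le> e \<Longrightarrow> x0 + v \<in> C \<and> F x0 (x0 + v) \<le> F x0 x0 + 1"
    using bounded_near_relcore[OF L C cvx[OF x0_in] lsc[OF x0_in] x0] by metis
  then have ball: "x0 + v \<in> C" if "v \<in> L" "norm v \<le> e" for v using that by simp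
  \<comment> \<open>A point of \<open>cone (C - b)\<close> close to \<open>w\<close> would, combined with a point of \<open>C\<close> near \<open>x0\<close>, yield a
    point of \<open>C\<close> beyond \<open>b\<close> on the segment.\<close>
  define \<kappa> where "\<kappa> = \<tau> / (1 - \<tau>) + 1"
  have \<kappa>: "0 < \<kappa>" using \<tau> by (simp add: \<kappa>_def add_nonneg_pos)
  have x0_eq: "x0 = b - (\<kappa> - 1) *\<^sub>R w"
    using \<tau> by (simp add: w \<kappa>_def b_def)
  define d where "d = min (norm w) (e / \<kappa>)"
  have d: "0 < d" using \<open>w \<noteq> 0\<close> e \<kappa> by (simp add: d_def)
  let ?S = "cone hull ((\<lambda>y. y - b) ` C)"
  have far: "d \<le> norm (v - w)" if v: "v \<in> ?S" for v
  proof (rule ccontr)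
    assume "\<not> ?thesis"
    then have close: "norm (v - w) < norm w" "norm (v - w) < e / \<kappa>" by (auto simp: d_def)
    obtain c y where cy: "v = c *\<^sub>R (y - b)" "0 \<le> c" "y \<in> C" using v by (auto simp: cone_hull_expl)
    have "v - w \<in> L"
      unfolding cy(1) using diff_L[OF cy(3) b] \<open>w \<in> L\<close> L(1) by (simp add: subspace_diff subspace_scale)
    then have "(- \<kappa>) *\<^sub>R (v - w) \<in> L" using L(1) by (rule subspace_scale[rotated])
    moreover have "norm ((- \<kappa>) *\<^sub>R (v - w)) \<le> e"
      using close(2) \<kappa> unfolding norm_scaleR by (simp add: field_simps)
    ultimately have x1: "x0 + (- \<kappa>) *\<^sub>R (v - w) \<in> C" by (rule ball)
    \<comment> \<open>With \<open>v = c *\<^sub>R (y - b)\<close>, the weights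
      \<open>\<kappa> * c / k\<close> and \<open>1 / k\<close> eliminate \<open>v\<close> and leave
      \<open>b + (1 / k) *\<^sub>R w\<close>.\<close>
    define k where "k = 1 + \<kappa> * c"
    have k: "1 \<le> k" using \<kappa> cy(2) by (simp add: k_def)
    have "\<kappa> * c / k + 1 / k = k / k"
      unfolding add_divide_distrib[symmetric] by (simp add: k_def)
    then have "(\<kappa> * c / k) *\<^sub>R y + (1 / k) *\<^sub>R (x0 + (- \<kappa>) *\<^sub>R (v - w)) \<in> C"
      using k \<kappa> cy(2) by (intro convexD[OF convex_C cy(3) x1]) auto
    moreover have "(\<kappa> * c / k) *\<^sub>R y + (1 / k) *\<^sub>R (x0 + (- \<kappa>) *\<^sub>R (v - w)) = b + (1 / k) *\<^sub>R w"
    proof -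
      have "k *\<^sub>R ((\<kappa> * c / k) *\<^sub>R y + (1 / k) *\<^sub>R (x0 + (- \<kappa>) *\<^sub>R (v - w))) =
        (\<kappa> * c) *\<^sub>R y + (x0 + (- \<kappa>) *\<^sub>R (v - w))"
        using k by (simp add: scaleR_add_right)
      also have "\<dots> = k *\<^sub>R b + w"
        unfolding x0_eq cy(1) by (simp add: k_def algebra_simps)
      also have "\<dots> = k *\<^sub>R (b + (1 / k) *\<^sub>R w)" using k by (simp add: scaleR_add_right)
      finally show ?thesis using k by simp
    qed
    moreover have "b + (1 / k) *\<^sub>R w = x0 + (\<tau> + (1 - \<tau>) / k) *\<^sub>R (z - x0)"
      by (simp add: b_def w scaleR_add_left)
    moreover have "\<tau> < \<tau> + (1 - \<tau>) / k" "\<tau> + (1 - \<tau>) / k \<le> 1"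
    proof -
      show "\<tau> < \<tau> + (1 - \<tau>) / k" using \<tau> k by simp
      have "(1 - \<tau>) / k \<le> (1 - \<tau>) / 1" using \<tau> k by (intro divide_left_mono) auto
      then show "\<tau> + (1 - \<tau>) / k \<le> 1" by simp
    qed
    ultimately show False using last by metis
  qed
  have "convex ?S"
    using convex_C by (intro convex_cone_hull) (simp add: convex_translation_subtract)
  moreover have "c *\<^sub>R v \<in> ?S" if "0 \<le> c" "v \<in> ?S" for c v
    using that mem_cone[OF cone_cone_hull] by blast
  moreover have sub: "(\<lambda>y. y - b) ` C \<subseteq> ?S" by (rule hull_subset)
  then have "?S \<noteq> {}" using b by blast
  ultimately obtain l :: "'a \<Rightarrow>\<^sub>L real" where "\<And>v. v \<in> ?S \<Longrightarrow> l v \<le> 0" "0 < l w"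
    using separate_point_convex_cone[OF _ _ _ d far] by blast
  then show thesis using that sub unfolding w_def by blast
qed

lemma related_imp_in_domain:
  assumes related: "\<And>x xs. xs \<in> bifun_op C F x \<Longrightarrow> 0 \<le> (zs - xs) (z - x)"
  shows "z \<in> C"
proof (rule ccontr)
  assume "z \<notin> C"
  let ?p = "\<lambda>\<sigma>::real. x0 + \<sigma> *\<^sub>R (z - x0)"
  have "compact ({0..1} \<inter> ?p -` C)"
    by (intro compact_Int_closed closed_vimage C continuous_intros) auto
  moreover have "0 \<in> {0..1} \<inter> ?p -` C" using x0_in by simp
  ultimately obtain \<tau> where \<tau>: "\<tau> \<in> {0..1} \<inter> ?p -` C"
    and max: "\<And>\<sigma>. \<sigma> \<in> {0..1} \<inter> ?p -` C \<Longrightarrow> \<sigma> \<le> \<tau>"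
    by (metis compact_attains_sup empty_iff)
  define b where "b = ?p \<tau>"
  have b: "b \<in> C" using \<tau> by (simp add: b_def)
  have "\<tau> \<noteq> 1" using \<tau> \<open>z \<notin> C\<close> by auto
  then have \<tau>': "0 \<le> \<tau>" "\<tau> < 1" using \<tau> by auto
  have last: "?p \<sigma> \<notin> C" if "\<tau> < \<sigma>" "\<sigma> \<le> 1" for \<sigma>
    using max[of \<sigma>] that \<tau>'(1) by auto
  obtain K where K: "\<And>y. y \<in> C \<Longrightarrow> - (K * norm (y - b)) \<le> F b y"
    using calm_on_segment[OF related \<tau>' b_def b] by metis
  obtain bs :: "'a \<Rightarrow>\<^sub>L real" where bs: "\<And>y. y \<in> C \<Longrightarrow> bs (y - b) \<le> F b y"
    using calm_imp_subgradient[OF cvx[OF b], of K b] K diag[OF b] by auto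
  obtain l :: "'a \<Rightarrow>\<^sub>L real" where l: "\<And>y. y \<in> C \<Longrightarrow> l (y - b) \<le> 0" "0 < l (z - b)"
    using normal_at_last_point[OF \<tau>' b_def b last] by metis
  \<comment> \<open>Large enough for \<open>c * l (z - b)\<close> to exceed
    \<open>(zs - bs) (z - b)\<close>, which relatedness at \<open>b\<close> forbids.\<close>
  define c where "c = (\<bar>(zs - bs) (z - b)\<bar> + 1) / l (z - b)"
  have c: "0 \<le> c" "c * l (z - b) = \<bar>(zs - bs) (z - b)\<bar> + 1" using l(2) by (auto simp: c_def)
  have "bs + c *\<^sub>R l \<in> bifun_op C F b"
    unfolding in_bifun_op_iff
  proof (intro conjI ballI b)
    fix y assume y: "y \<in> C"
    have "c * l (y - b) \<le> 0" using l(1)[OF y] c(1) by (simp add: mult_nonneg_nonpos)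
    then show "(bs + c *\<^sub>R l) (y - b) \<le> F b y"
      using bs[OF y] by (simp add: blinfun.add_left blinfun.scaleR_left)
  qed
  then have "0 \<le> (zs - (bs + c *\<^sub>R l)) (z - b)" by (rule related)
  also have "\<dots> = (zs - bs) (z - b) - c * l (z - b)"
    by (simp add: blinfun.diff_left blinfun.add_left blinfun.scaleR_left)
  finally show False using c(2) by linarith
qed

end

section \<open>Maximality from a point of the strong quasi relative interior\<close>

theorem theorem7:
  fixes C :: "'a::banach set" and F :: "'a \<Rightarrow> 'a \<Rightarrow> real"
  assumes nontrivial: "\<exists>v::'a. v \<noteq> 0"
    and "C \<noteq> {}" and "convex C" and "closed C"
    and "sqri C \<noteq> {}"
    and "\<And>x. x \<in> C \<Longrightarrow> F x x = 0"
    and "\<And>x. x \<in> C \<Longrightarrow> convex_on C (\<lambda>y. F x y)"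
    and "\<And>x. x \<in> C \<Longrightarrow> lower_semicontinuous_on C (\<lambda>y. F x y)"
    and "\<And>y. y \<in> C \<Longrightarrow> concave_on C (\<lambda>x. F x y)"
    and "\<And>y. y \<in> C \<Longrightarrow> upper_semicontinuous_on C (\<lambda>x. F x y)"
  shows "maximal_monotone_operator (bifun_op C F) \<and> bifun_op C F = bifun_op_left C F"
proof
  obtain x0 where "x0 \<in> sqri C" using \<open>sqri C \<noteq> {}\<close> by blast
  define L where "L = cone hull ((\<lambda>u. u - x0) ` C)"
  have x0: "x0 \<in> C" and L: "subspace L" "closed L"
    using \<open>x0 \<in> sqri C\<close> by (auto simp: sqri_def L_def)
  have L0: "u - x0 \<in> L" if "u \<in> C" for u
    using that hull_subset[of "(\<lambda>u. u - x0) ` C" cone] by (auto simp: L_def)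
  have diff: "x - y \<in> L" if "x \<in> C" "y \<in> C" for x y
    using subspace_diff[OF L(1) L0[OF that(1)] L0[OF that(2)]] by simp
  have core: "x0 \<in> relcore L C"
    unfolding relcore_def
  proof (intro CollectI conjI ballI x0)
    fix v assume "v \<in> L"
    then obtain c u where v: "v = c *\<^sub>R (u - x0)" "0 \<le> c" "u \<in> C"
      by (auto simp: L_def cone_hull_expl)
    \<comment> \<open>For \<open>c\<close> nonzero, the step 1/c leads from \<open>x0\<close>
      exactly to \<open>u\<close>.\<close>
    show "\<exists>t>0. x0 + t *\<^sub>R v \<in> C"
    proof (cases "c = 0")
      case True
      then show ?thesis using v x0 by (intro exI[of _ 1]) simp
    next
      case False
      then show ?thesis using v by (intro exI[of _ "inverse c"]) simp
    qed
  qed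
  interpret saddle_bifunction C L F x0
    by (rule saddle_bifunction.intro) (fact L core diff assms(4,6-10))+
  show eq: "bifun_op C F = bifun_op_left C F"
    using diag cvx lsc ccv usc by (rule bifun_op_eq_bifun_op_left)
  show "maximal_monotone_operator (bifun_op C F)"
    unfolding maximal_monotone_operator_def
  proof (intro conjI notI)
    show "monotone_operator (bifun_op C F)" using eq diag by (rule monotone_bifun_op)
    assume "\<exists>S. monotone_operator S \<and> op_graph (bifun_op C F) \<subset> op_graph S"
    then obtain S where S: "monotone_operator S" and sub: "op_graph (bifun_op C F) \<subset> op_graph S"
      by blast
    obtain z zs where z: "zs \<in> S z" "zs \<notin> bifun_op C F z"
      using sub by (auto simp: op_graph_def)
    \<comment> \<open>Both pairs lie in the graph of the monotone extension
      \<open>S\<close>.\<close>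
    have related: "0 \<le> (zs - xs) (z - x)" if "xs \<in> bifun_op C F x" for x xs
      using S that z(1) sub unfolding monotone_operator_def op_graph_def by blast
    show False
      using related_in_domain[OF related related_imp_in_domain[OF related]] z(2) by blast
  qed
qed

end
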